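(* Let $q \geq 2$ be an integer such that an affine plane of order $q$ exists and let $s$ be an integer such that $s \geq 2q+1$. Then $C_1(v,sq) = q^2+q$ for each integer $v$ such that $sq^2-q+1-z < v \leq sq^2$, where $$z=\begin{cases} \min\left(q-1,\frac{q(s-2q-1)+2}{q+1}\right), & \text{if } 2q+1 \leq s \leq 4q+1;\\[0.2cm] \frac{q^2(s-q-2)-q+2}{3q^2+3q-2}, & \text{if } s \geq 4q+2.\end{cases}$$
   Context: A $(v,k,\lambda)$-covering is a pair $(V,\mathcal{B})$ where $V$ is a set of $v$ points and $\mathcal{B}$ is a collection of $k$-subsets of $V$ (blocks) such that every pair of distinct points lies together in at least $\lambda$ blocks; $C_\lambda(v,k)$ is the minimum number of blocks in a $(v,k,\lambda)$-covering. An affine plane of order $q$ is a $(q^2,q,1)$-design, i.e. a set of $q^2$ points with a collection of $q$-subsets such that every pair of distinct points lies in exactly one block. *)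

theory Defs
  imports Complex_Main "HOL-Library.Multiset"
begin

text \<open>
  The blocks form a multiset, so that repeated blocks are allowed and counted with multiplicity.
\<close>

definition covering :: "nat \<Rightarrow> nat \<Rightarrow> nat \<Rightarrow> 'a set \<Rightarrow> 'a set multiset \<Rightarrow> bool" where
  "covering v k l V B \<longleftrightarrow>
     finite V \<and> card V = v \<and>
     (\<forall>b \<in># B. b \<subseteq> V \<and> card b = k) \<and>
     (\<forall>x \<in> V. \<forall>y \<in> V. x \<noteq> y \<longrightarrow> size {#b \<in># B. x \<in> b \<and> y \<in> b#} \<ge> l)"

definition design :: "nat \<Rightarrow> nat \<Rightarrow> nat \<Rightarrow> 'a set \<Rightarrow> 'a set multiset \<Rightarrow> bool" where
  "design v k l V B \<longleftrightarrow>
     finite V \<and> card V = v \<and>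
     (\<forall>b \<in># B. b \<subseteq> V \<and> card b = k) \<and>
     (\<forall>x \<in> V. \<forall>y \<in> V. x \<noteq> y \<longrightarrow> size {#b \<in># B. x \<in> b \<and> y \<in> b#} = l)"

definition affine_plane :: "nat \<Rightarrow> 'a set \<Rightarrow> 'a set multiset \<Rightarrow> bool" where
  "affine_plane q V B \<longleftrightarrow> design (q\<^sup>2) q 1 V B"

text \<open>
  Taking points in \<^typ>\<open>nat\<close> loses no generality, since every finite point set can be
  relabelled by naturals.  The value is meaningful only if some \<open>(v, k, l)\<close>-covering exists
  (for \<open>2 \<le> k\<close> this holds whenever \<open>k \<le> v\<close>).
\<close>

definition covering_number :: "nat \<Rightarrow> nat \<Rightarrow> nat \<Rightarrow> nat" where
  "covering_number l v k =
     (LEAST n. \<exists>(V :: nat set) B. covering v k l V B \<and> size B = n)"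

end

theory Submission
  imports Defs
begin

text \<open>
  For the upper bound, replace every point of the affine plane by at most \<open>s\<close> copies and pad the
  blown-up lines.

  For the lower bound, every point has degree at least \<open>q\<close>; let \<open>S\<close> be the set of points of
  degree exactly \<open>q\<close>. The numbers of surplus blocks on pairs form a multigraph in which every
  vertex of \<open>S\<close> has degree \<open>d = s q\<^sup>2 - q + 1 - v\<close> (so \<open>S\<close> is empty if \<open>d < 0\<close>). By an argument
  of Lovasz \<open>S\<close> splits into \<open>t = \<lfloor>max d 0 / (q - 1)\<rfloor> + 1\<close> classes inside which all degrees are below \<open>q - 1\<close>. On each class
  the Gram matrix of the incidence vectors is positive definite, so as in Bose's proof of Fisher's
  inequality a class has at most \<open>b\<close> points, \<open>b\<close> being the number of blocks. Hence
  \<open>\<bar>S\<bar> \<le> t b\<close>, and counting incidences gives \<open>v (q + 1) \<le> b (s q + t)\<close>, which forces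
  \<open>b \<ge> q\<^sup>2 + q\<close>.
\<close>

section \<open>Double counting of incidences in an indexed family of blocks\<close>

text \<open>On the diagonal this is the degree of a point.\<close>

definition joint_degree :: "'i set \<Rightarrow> ('i \<Rightarrow> 'a set) \<Rightarrow> 'a \<Rightarrow> 'a \<Rightarrow> nat" where
  "joint_degree I F x y = card {i \<in> I. x \<in> F i \<and> y \<in> F i}"

lemma joint_degree_commute: "joint_degree I F x y = joint_degree I F y x"
  unfolding joint_degree_def by (rule arg_cong[where f = card]) auto

lemma of_nat_joint_degree:
  assumes "finite I"
  shows "of_nat (joint_degree I F x y)
           = (\<Sum>i\<in>I. of_bool (x \<in> F i) * of_bool (y \<in> F i) :: 'b :: semiring_1)"
proof -
  have "{i \<in> I. x \<in> F i \<and> y \<in> F i} = I \<inter> {i. x \<in> F i \<and> y \<in> F i}" by auto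
  then show ?thesis
    using assms by (simp add: joint_degree_def sum_of_bool_eq flip: of_bool_conj)
qed

lemma sum_joint_degree:
  assumes "finite I" "finite A"
  shows "(\<Sum>y\<in>A. joint_degree I F x y) = (\<Sum>i | i \<in> I \<and> x \<in> F i. card (A \<inter> F i))"
proof -
  have "(\<Sum>y\<in>A. joint_degree I F x y)
          = (\<Sum>y\<in>A. \<Sum>i\<in>I. of_bool (x \<in> F i) * of_bool (y \<in> F i))"
    using of_nat_joint_degree[OF assms(1), where 'b = nat] by (intro sum.cong) simp_all
  also have "\<dots> = (\<Sum>i\<in>I. \<Sum>y\<in>A. of_bool (x \<in> F i) * of_bool (y \<in> F i))"
    by (rule sum.swap)
  also have "\<dots> = (\<Sum>i\<in>I. of_bool (x \<in> F i) * card (A \<inter> F i))"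
    using assms by (simp add: sum_of_bool_eq Int_def flip: sum_distrib_left)
  also have "\<dots> = (\<Sum>i | i \<in> I \<and> x \<in> F i. card (A \<inter> F i))"
    using assms by (intro sum.mono_neutral_cong_right) auto
  finally show ?thesis .
qed

lemma sum_joint_degree_neq:
  assumes "finite I" "finite V" "\<And>i. i \<in> I \<Longrightarrow> F i \<subseteq> V \<and> card (F i) = k"
  shows "(\<Sum>y\<in>V-{x}. joint_degree I F x y) = joint_degree I F x x * (k - 1)"
proof -
  have "card ((V - {x}) \<inter> F i) = k - 1" if "i \<in> I" "x \<in> F i" for i
  proof -
    have "(V - {x}) \<inter> F i = F i - {x}" using assms(3) that by auto
    then show ?thesis using assms(3) that by simp
  qed
  then show ?thesis
    using assms by (simp add: sum_joint_degree) (simp add: joint_degree_def)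
qed

lemma sum_degree:
  assumes "finite I" "finite V" "\<And>i. i \<in> I \<Longrightarrow> F i \<subseteq> V \<and> card (F i) = k"
  shows "(\<Sum>x\<in>V. joint_degree I F x x) = card I * k"
proof -
  have "(\<Sum>x\<in>V. joint_degree I F x x) = (\<Sum>x\<in>V. \<Sum>i\<in>I. of_bool (x \<in> F i))"
  proof (intro sum.cong refl)
    show "joint_degree I F x x = (\<Sum>i\<in>I. of_bool (x \<in> F i))" for x
      using of_nat_joint_degree[OF assms(1), of F x x, where 'b = nat] by (simp flip: of_bool_conj)
  qed
  also have "\<dots> = (\<Sum>i\<in>I. \<Sum>x\<in>V. of_bool (x \<in> F i))"
    by (rule sum.swap)
  also have "\<dots> = (\<Sum>i\<in>I. card (V \<inter> F i))"
    using assms by (simp add: sum_of_bool_eq Int_def)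
  also have "\<dots> = (\<Sum>i\<in>I. k)"
    using assms(3) by (intro sum.cong) (auto simp: Int_absorb1)
  finally show ?thesis by simp
qed

section \<open>Linear algebra for Fisher-type inequalities\<close>

text \<open>Gaussian elimination: each equation either vanishes identically or removes one unknown,
  so an unknown is still free when the equations run out.\<close>

lemma homogeneous_system_nontrivial_solution:
  fixes c :: "'i \<Rightarrow> 'a \<Rightarrow> 'b :: field"
  assumes "finite I" "finite T" "card I < card T"
  shows "\<exists>w. (\<exists>x\<in>T. w x \<noteq> 0) \<and> (\<forall>i\<in>I. (\<Sum>x\<in>T. c i x * w x) = 0)"
  using assms
proof (induction I arbitrary: T c rule: finite_induct)
  case empty
  then obtain x where "x \<in> T" by fastforce
  then show ?case by (intro exI[of _ "\<lambda>_. 1"]) auto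
next
  case (insert j I)
  show ?case
  proof (cases "\<exists>p\<in>T. c j p \<noteq> 0")
    case False
    then show ?thesis using insert.IH[of T c] insert by auto
  next
    case True
    then obtain p where p: "p \<in> T" "c j p \<noteq> 0" by blast
    define T' where "T' = T - {p}"
    have T': "finite T'" "p \<notin> T'" "T = insert p T'" "card I < card T'"
      using insert p by (auto simp: T'_def)
    \<comment> \<open>These coefficients arise when equation \<open>j\<close> is solved for the
      unknown at the pivot \<open>p\<close> and the result is substituted into the other
      equations.\<close>
    obtain w where w: "\<exists>x\<in>T'. w x \<noteq> 0"
        "\<And>i. i \<in> I \<Longrightarrow> (\<Sum>x\<in>T'. (c i x - c i p * c j x / c j p) * w x) = 0"
      using insert.IH[OF T'(1,4), of "\<lambda>i x. c i x - c i p * c j x / c j p"] by blast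
    define w' where "w' = w(p := - (\<Sum>x\<in>T'. c j x * w x) / c j p)"
    have sum_w': "(\<Sum>x\<in>T. c i x * w' x)
        = (\<Sum>x\<in>T'. c i x * w x) - c i p * (\<Sum>x\<in>T'. c j x * w x) / c j p" for i
    proof -
      have "(\<Sum>x\<in>T'. c i x * w' x) = (\<Sum>x\<in>T'. c i x * w x)"
        using T' by (intro sum.cong) (auto simp: w'_def)
      then show ?thesis using T' by (simp add: w'_def)
    qed
    have "(\<Sum>x\<in>T. c i x * w' x) = 0" if "i \<in> I" for i
      using w(2)[OF that] unfolding sum_w'
      by (simp add: algebra_simps sum_subtractf sum_distrib_left sum_divide_distrib)
    moreover have "(\<Sum>x\<in>T. c j x * w' x) = 0"
      unfolding sum_w' using p by simp
    moreover have "\<exists>x\<in>T. w' x \<noteq> 0"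
      using w(1) T' by (auto simp: w'_def)
    ultimately show ?thesis by (intro exI[of _ w']) auto
  qed
qed

text \<open>With more points than blocks, the incidence vectors of the points would be linearly
  dependent, and their Gram matrix would kill some nonzero \<open>w\<close>. But that matrix is
  \<open>l\<close> times the all-ones matrix plus a symmetric, strictly diagonally dominant one,
  hence positive definite.\<close>

lemma card_le_of_diagonally_dominant:
  fixes l :: real
  assumes fin: "finite I" "finite T" and "0 \<le> l"
    and ge: "\<And>x y. x \<in> T \<Longrightarrow> y \<in> T \<Longrightarrow> x \<noteq> y \<Longrightarrow> l \<le> joint_degree I F x y"
    and dom: "\<And>x. x \<in> T \<Longrightarrow>
      (\<Sum>y\<in>T-{x}. real (joint_degree I F x y) - l) < real (joint_degree I F x x) - l"
  shows "card T \<le> card I"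
proof (rule ccontr)
  assume "\<not> card T \<le> card I"
  then obtain w where w: "\<exists>x\<in>T. w x \<noteq> 0"
      "\<And>i. i \<in> I \<Longrightarrow> (\<Sum>x\<in>T. of_bool (x \<in> F i) * w x) = (0 :: real)"
    using homogeneous_system_nontrivial_solution[OF fin, of "\<lambda>i x. of_bool (x \<in> F i)"] by auto
  define a where "a x y = real (joint_degree I F x y) - l" for x y
  have a_sym: "a x y = a y x" for x y
    by (simp add: a_def joint_degree_commute)
  \<comment> \<open>Being zero on the diagonal, \<open>h\<close> lets off-diagonal sums run over all
    of \<open>T\<close>, so that they can be swapped.\<close>
  define h where "h x y = (if x = y then 0 else a x y)" for x y
  have sum_h: "(\<Sum>y\<in>T. h x y * u y) = (\<Sum>y\<in>T-{x}. a x y * u y)" if "x \<in> T" for x u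
    using fin that by (intro sum.mono_neutral_cong_right) (auto simp: h_def)
  have "0 = (\<Sum>i\<in>I. (\<Sum>x\<in>T. of_bool (x \<in> F i) * w x)\<^sup>2)"
    using w(2) by simp
  also have "\<dots> = (\<Sum>i\<in>I. \<Sum>x\<in>T. \<Sum>y\<in>T. of_bool (x \<in> F i) * of_bool (y \<in> F i) * (w x * w y))"
    by (simp add: power2_eq_square sum_product mult_ac)
  also have "\<dots> = (\<Sum>x\<in>T. \<Sum>y\<in>T. \<Sum>i\<in>I. of_bool (x \<in> F i) * of_bool (y \<in> F i) * (w x * w y))"
    by (subst sum.swap) (subst (2) sum.swap, rule refl)
  also have "\<dots> = (\<Sum>x\<in>T. \<Sum>y\<in>T. (a x y + l) * (w x * w y))"
    by (simp add: a_def of_nat_joint_degree[OF fin(1)] flip: sum_distrib_right)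
  also have "\<dots> = (\<Sum>x\<in>T. \<Sum>y\<in>T. a x y * (w x * w y)) + l * (\<Sum>x\<in>T. w x)\<^sup>2"
    unfolding power2_eq_square sum_product
    by (simp add: distrib_right sum.distrib sum_distrib_left)
  also have "(\<Sum>x\<in>T. \<Sum>y\<in>T. a x y * (w x * w y))
      = (\<Sum>x\<in>T. a x x * (w x)\<^sup>2) + (\<Sum>x\<in>T. \<Sum>y\<in>T. h x y * (w x * w y))"
  proof -
    have "(\<Sum>y\<in>T. a x y * (w x * w y)) = a x x * (w x)\<^sup>2 + (\<Sum>y\<in>T. h x y * (w x * w y))"
      if "x \<in> T" for x
      using sum_h[OF that, of "\<lambda>y. w x * w y"] sum.remove[OF fin(2) that]
      by (simp add: power2_eq_square)
    then show ?thesis by (simp add: sum.distrib)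
  qed
  finally have zero: "(\<Sum>x\<in>T. a x x * (w x)\<^sup>2) + (\<Sum>x\<in>T. \<Sum>y\<in>T. h x y * (w x * w y))
      + l * (\<Sum>x\<in>T. w x)\<^sup>2 = 0" by simp
  \<comment> \<open>As \<open>h\<close> is nonnegative,
    \<open>- 2 * w x * w y \<le> (w x)^2 + (w y)^2\<close> applies termwise; the symmetry of
    \<open>h\<close> then turns the right-hand side into row sums times
    \<open>(w x)^2\<close>.\<close>
  have "- (\<Sum>x\<in>T. \<Sum>y\<in>T. h x y * (w x * w y))
      \<le> (\<Sum>x\<in>T. \<Sum>y\<in>T. h x y * ((w x)\<^sup>2 + (w y)\<^sup>2) / 2)"
    unfolding sum_negf[symmetric]
  proof (intro sum_mono)
    fix x y assume "x \<in> T" "y \<in> T"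
    then have "0 \<le> h x y" using ge by (auto simp: h_def a_def)
    moreover have square: "((w x)\<^sup>2 + (w y)\<^sup>2) / 2 + w x * w y = (w x + w y)\<^sup>2 / 2"
      by (simp add: power2_sum add_divide_distrib)
    have "0 \<le> ((w x)\<^sup>2 + (w y)\<^sup>2) / 2 + w x * w y" unfolding square by simp
    ultimately have "0 \<le> h x y * (((w x)\<^sup>2 + (w y)\<^sup>2) / 2 + w x * w y)" by simp
    also have "\<dots> = h x y * ((w x)\<^sup>2 + (w y)\<^sup>2) / 2 + h x y * (w x * w y)"
      by (simp add: distrib_left)
    finally show "- (h x y * (w x * w y)) \<le> h x y * ((w x)\<^sup>2 + (w y)\<^sup>2) / 2" by simp
  qed
  also have "\<dots> = (\<Sum>x\<in>T. \<Sum>y\<in>T. h x y * (w x)\<^sup>2 / 2) + (\<Sum>x\<in>T. \<Sum>y\<in>T. h x y * (w y)\<^sup>2 / 2)"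
    by (simp add: distrib_left add_divide_distrib sum.distrib)
  also have "(\<Sum>x\<in>T. \<Sum>y\<in>T. h x y * (w y)\<^sup>2 / 2) = (\<Sum>x\<in>T. \<Sum>y\<in>T. h x y * (w x)\<^sup>2 / 2)"
    by (subst sum.swap) (intro sum.cong refl, auto simp: h_def a_sym)
  also have "(\<Sum>x\<in>T. \<Sum>y\<in>T. h x y * (w x)\<^sup>2 / 2) + (\<Sum>x\<in>T. \<Sum>y\<in>T. h x y * (w x)\<^sup>2 / 2)
      = (\<Sum>x\<in>T. (\<Sum>y\<in>T. h x y * 1) * (w x)\<^sup>2)"
    by (simp add: sum_distrib_right flip: sum.distrib)
  also have "\<dots> = (\<Sum>x\<in>T. (\<Sum>y\<in>T-{x}. a x y) * (w x)\<^sup>2)"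
    by (intro sum.cong refl) (subst sum_h, auto)
  \<comment> \<open>Dominance gives the comparison termwise; it is strict at a point where
    \<open>w\<close> does not vanish.\<close>
  also have "\<dots> < (\<Sum>x\<in>T. a x x * (w x)\<^sup>2)"
  proof (rule sum_strict_mono_ex1[OF fin(2)])
    show "\<forall>x\<in>T. (\<Sum>y\<in>T-{x}. a x y) * (w x)\<^sup>2 \<le> a x x * (w x)\<^sup>2"
      using dom by (intro ballI mult_right_mono) (simp_all add: a_def less_imp_le)
    show "\<exists>x\<in>T. (\<Sum>y\<in>T-{x}. a x y) * (w x)\<^sup>2 < a x x * (w x)\<^sup>2"
      using dom w(1) unfolding a_def by (meson mult_strict_right_mono zero_less_power2)
  qed
  finally show False
    using zero mult_nonneg_nonneg[OF \<open>0 \<le> l\<close> zero_le_power2[of "\<Sum>x\<in>T. w x"]] by linarith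
qed

section \<open>Splitting a multigraph into classes of small degree\<close>

text \<open>Take a colouring that minimises the total weight of the monochromatic pairs.\<close>

lemma partition_into_low_degree_classes:
  fixes a :: "'a \<Rightarrow> 'a \<Rightarrow> nat"
  assumes fin: "finite S" and sym: "\<And>x y. a x y = a y x" and "0 < t"
  shows "\<exists>f. (\<forall>x. f x < t) \<and>
    (\<forall>x\<in>S. t * (\<Sum>y | y \<in> S - {x} \<and> f y = f x. a x y) \<le> (\<Sum>y\<in>S-{x}. a x y))"
proof -
  define W where "W f u y = (if u \<noteq> y \<and> f u = f y then a u y else 0)" for f :: "'a \<Rightarrow> nat" and u y
  define cost where "cost f = (\<Sum>u\<in>S. \<Sum>y\<in>S. W f u y)" for f
  obtain f where f: "\<forall>x. f x < t" and min: "\<And>g. \<forall>x. g x < t \<Longrightarrow> cost f \<le> cost g"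
    using ex_has_least_nat[of "\<lambda>f. \<forall>x. f x < t" "\<lambda>_. 0" cost] \<open>0 < t\<close> by blast
  have "t * (\<Sum>y | y \<in> S - {x} \<and> f y = f x. a x y) \<le> (\<Sum>y\<in>S-{x}. a x y)" if x: "x \<in> S" for x
  proof -
    define D where "D c = (\<Sum>y | y \<in> S - {x} \<and> f y = c. a x y)" for c
    define R where "R = (\<Sum>u\<in>S-{x}. \<Sum>y\<in>S-{x}. W f u y)"
    have S: "S = insert x (S - {x})" using x by auto
    \<comment> \<open>Recolouring \<open>x\<close> leaves \<open>R\<close>, the share of the pairs
      avoiding \<open>x\<close>, unchanged. The factor 2 appears because \<open>cost\<close> runs
      over ordered pairs.\<close>
    have cost_upd: "cost (f(x := c)) = R + 2 * D c" for c
    proof -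
      let ?g = "f(x := c)"
      have "(\<Sum>y\<in>S-{x}. W ?g x y) = D c"
        unfolding D_def using fin by (intro sum.mono_neutral_cong_right) (auto simp: W_def)
      moreover have "(\<Sum>u\<in>S-{x}. W ?g u x) = (\<Sum>y\<in>S-{x}. W ?g x y)"
        by (intro sum.cong) (auto simp: W_def sym)
      moreover have "(\<Sum>u\<in>S-{x}. \<Sum>y\<in>S-{x}. W ?g u y) = R"
        unfolding R_def by (intro sum.cong) (auto simp: W_def)
      moreover have "cost ?g = W ?g x x + (\<Sum>y\<in>S-{x}. W ?g x y)
          + ((\<Sum>u\<in>S-{x}. W ?g u x) + (\<Sum>u\<in>S-{x}. \<Sum>y\<in>S-{x}. W ?g u y))"
        unfolding cost_def using fin x by (simp add: sum.remove[OF fin x] sum.distrib)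
      moreover have "W ?g x x = 0" by (simp add: W_def)
      ultimately show ?thesis by simp
    qed
    \<comment> \<open>Minimality is tested against recolouring \<open>x\<close> only;
      \<open>f\<close> itself is the case \<open>c = f x\<close>. So the weight from
      \<open>x\<close> into its own class is the least of \<open>t\<close> weights and hence at most
      their average.\<close>
    have "D (f x) \<le> D c" if "c < t" for c
      using min[of "f(x := c)"] f that cost_upd[of c] cost_upd[of "f x"] by simp
    then have "t * D (f x) \<le> (\<Sum>c<t. D c)"
      using sum_mono[of "{..<t}" "\<lambda>_. D (f x)" D] by simp
    also have "\<dots> = (\<Sum>y\<in>S-{x}. a x y)"
    proof -
      have "D c = (\<Sum>y | y \<in> S - {x} \<and> f y = c. a x y)" for c by (simp add: D_def)
      then show ?thesis
        using sum.group[of "S - {x}" "{..<t}" f "a x"] fin f by auto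
    qed
    finally show ?thesis by (simp add: D_def)
  qed
  with f show ?thesis by blast
qed

section \<open>The lower bound for coverings\<close>

text \<open>At a point of degree \<open>r\<close> the total surplus is
  \<open>r * (k - 1) - (card V - 1)\<close>, which \<open>excess\<close> puts below
  \<open>t * (r - 1)\<close>. Split among \<open>t\<close> classes, it drops below
  \<open>r - 1\<close> inside each class, which is the dominance required for the Gram matrix with
  \<open>l = 1\<close>.\<close>

lemma fisher_type_bound:
  assumes fin: "finite I" "finite V"
    and blocks: "\<And>i. i \<in> I \<Longrightarrow> F i \<subseteq> V \<and> card (F i) = k"
    and cover: "\<And>x y. x \<in> V \<Longrightarrow> y \<in> V \<Longrightarrow> x \<noteq> y \<Longrightarrow> 1 \<le> joint_degree I F x y"
    and degree: "\<And>x. x \<in> V \<Longrightarrow> r \<le> joint_degree I F x x"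
    and "0 < t" and excess: "r * (k - 1) < card V - 1 + t * (r - 1)"
  shows "card V * (r + 1) \<le> card I * (k + t)"
proof -
  define S where "S = {x \<in> V. joint_degree I F x x = r}"
  have S: "S \<subseteq> V" "finite S" using fin by (auto simp: S_def)
  \<comment> \<open>The surplus of a pair. The truncated subtraction is exact for distinct points of
    \<open>V\<close>, by \<open>cover\<close>.\<close>
  define a where "a x y = joint_degree I F x y - 1" for x y
  have a_sum: "(\<Sum>y\<in>V-{x}. a x y) < t * (r - 1)" if "x \<in> S" for x
  proof -
    have x: "x \<in> V" "joint_degree I F x x = r" using that by (auto simp: S_def)
    have "(\<Sum>y\<in>V-{x}. a x y) + (card V - 1) = (\<Sum>y\<in>V-{x}. a x y + 1)"
      using x fin by (simp add: sum_Suc)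
    also have "\<dots> = (\<Sum>y\<in>V-{x}. joint_degree I F x y)"
    proof (intro sum.cong refl)
      show "a x y + 1 = joint_degree I F x y" if "y \<in> V - {x}" for y
        using cover[of x y] x that by (auto simp: a_def)
    qed
    also have "\<dots> = r * (k - 1)"
      using sum_joint_degree_neq[OF fin blocks, where x = x] x by simp
    finally show ?thesis using excess by linarith
  qed
  obtain f where f: "\<And>x. f x < t" "\<And>x. x \<in> S \<Longrightarrow>
      t * (\<Sum>y | y \<in> S - {x} \<and> f y = f x. a x y) \<le> (\<Sum>y\<in>S-{x}. a x y)"
    using partition_into_low_degree_classes[OF S(2), of a t] \<open>0 < t\<close>
    by (auto simp: a_def joint_degree_commute)
  have card_class: "card {x \<in> S. f x = c} \<le> card I" for c
  proof (rule card_le_of_diagonally_dominant[where l = 1])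
    fix x assume "x \<in> {x \<in> S. f x = c}"
    then have x: "x \<in> S" "f x = c" by auto
    have eq: "{x \<in> S. f x = c} - {x} = {y. y \<in> S - {x} \<and> f y = f x}" using x by auto
    have "t * (\<Sum>y | y \<in> S - {x} \<and> f y = f x. a x y) \<le> (\<Sum>y\<in>S-{x}. a x y)"
      using f(2)[OF x(1)] by simp
    also have "\<dots> \<le> (\<Sum>y\<in>V-{x}. a x y)"
      using S fin by (intro sum_mono2) auto
    also have "\<dots> < t * (r - 1)" using a_sum x by blast
    finally have "(\<Sum>y | y \<in> S - {x} \<and> f y = f x. a x y) < r - 1" by simp
    then have "(\<Sum>y | y \<in> S - {x} \<and> f y = f x. real (a x y)) < real r - 1"
      unfolding of_nat_sum[symmetric] by linarith
    moreover have "(\<Sum>y | y \<in> S - {x} \<and> f y = f x. real (a x y))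
        = (\<Sum>y | y \<in> S - {x} \<and> f y = f x. real (joint_degree I F x y) - 1)"
    proof (intro sum.cong refl)
      show "real (a x y) = real (joint_degree I F x y) - 1"
        if "y \<in> {y. y \<in> S - {x} \<and> f y = f x}" for y
      proof -
        have "1 \<le> joint_degree I F x y" using that x S by (intro cover) auto
        then show ?thesis by (simp add: a_def of_nat_diff)
      qed
    qed
    ultimately show "(\<Sum>y\<in>{x \<in> S. f x = c} - {x}. real (joint_degree I F x y) - 1)
        < real (joint_degree I F x x) - 1"
      unfolding eq using x by (auto simp: S_def)
  qed (use S fin cover in \<open>auto simp: Suc_le_eq\<close>)
  have "card S = (\<Sum>c<t. card {x \<in> S. f x = c})"
    using sum.group[of S "{..<t}" f "\<lambda>_. 1 :: nat"] S f(1) by (simp add: image_subset_iff)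
  also have "\<dots> \<le> t * card I"
    using sum_mono[of "{..<t}" "\<lambda>c. card {x \<in> S. f x = c}" "\<lambda>_. card I"] card_class by simp
  finally have card_S: "card S \<le> t * card I" .
  \<comment> \<open>Points outside \<open>S\<close> have degree at least \<open>r + 1\<close>; the
    indicator supplies the missing 1 for points in \<open>S\<close>.\<close>
  have "card V * (r + 1) = (\<Sum>x\<in>V. r + 1)" by simp
  also have "\<dots> \<le> (\<Sum>x\<in>V. joint_degree I F x x + of_bool (x \<in> S))"
  proof (intro sum_mono)
    fix x assume "x \<in> V"
    with degree[of x] show "r + 1 \<le> joint_degree I F x x + of_bool (x \<in> S)"
      by (auto simp: S_def)
  qed
  also have "\<dots> = card I * k + card S"
  proof -
    have "V \<inter> S = S" using S by auto
    then show ?thesis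
      using sum_degree[OF fin blocks] fin by (simp add: sum.distrib sum_of_bool_eq)
  qed
  finally show ?thesis using card_S by (simp add: algebra_simps)
qed

lemma size_filter_mset_mset:
  "size {#b \<in># mset xs. P b#} = card {i \<in> {..<length xs}. P (xs ! i)}"
  by (simp add: length_filter_conv_card flip: mset_filter)

text \<open>Each block through \<open>x\<close> reaches only \<open>k - 1\<close> other points, and
  together these blocks must reach all of them.\<close>

lemma covering_degree_ge:
  assumes "finite I" "finite V"
    and "\<And>i. i \<in> I \<Longrightarrow> F i \<subseteq> V \<and> card (F i) = k"
    and cover: "\<And>x y. x \<in> V \<Longrightarrow> y \<in> V \<Longrightarrow> x \<noteq> y \<Longrightarrow> 1 \<le> joint_degree I F x y"
    and "x \<in> V"
  shows "card V - 1 \<le> joint_degree I F x x * (k - 1)"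
proof -
  have "card V - 1 = (\<Sum>y\<in>V-{x}. 1)" using assms by simp
  also have "\<dots> \<le> (\<Sum>y\<in>V-{x}. joint_degree I F x y)"
    using cover \<open>x \<in> V\<close> by (intro sum_mono) auto
  also have "\<dots> = joint_degree I F x x * (k - 1)"
    by (rule sum_joint_degree_neq[OF assms(1-3)])
  finally show ?thesis .
qed

text \<open>Indexing the blocks by list positions preserves their multiplicities. The hypothesis
  \<open>low\<close> rules out points of degree below \<open>r\<close>.\<close>

lemma covering_size_bound:
  assumes "covering v k 1 V B" and "0 < t"
    and low: "(r - 1) * (k - 1) < v - 1"
    and excess: "r * (k - 1) < v - 1 + t * (r - 1)"
  shows "v * (r + 1) \<le> size B * (k + t)"
proof -
  obtain xs where xs: "mset xs = B" using ex_mset by blast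
  define I where "I = {..<length xs}"
  have I: "finite I" by (simp add: I_def)
  have V: "finite V" "card V = v" using assms(1) by (auto simp: covering_def)
  have blocks: "xs ! i \<subseteq> V \<and> card (xs ! i) = k" if "i \<in> I" for i
  proof -
    have "xs ! i \<in># B" using that xs by (auto simp: I_def)
    then show ?thesis using assms(1) by (auto simp: covering_def)
  qed
  have cover: "1 \<le> joint_degree I ((!) xs) x y" if "x \<in> V" "y \<in> V" "x \<noteq> y" for x y
    using assms(1) that
    by (auto simp: covering_def joint_degree_def I_def size_filter_mset_mset simp flip: xs)
  have degree: "r \<le> joint_degree I ((!) xs) x x" if "x \<in> V" for x
  proof (rule ccontr)
    assume "\<not> ?thesis"
    then have "joint_degree I ((!) xs) x x * (k - 1) \<le> (r - 1) * (k - 1)"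
      by (intro mult_right_mono) auto
    moreover have "v - 1 \<le> joint_degree I ((!) xs) x x * (k - 1)"
      using covering_degree_ge[OF _ V(1) blocks cover that] V by (simp add: I_def)
    ultimately show False using low by linarith
  qed
  have "card V * (r + 1) \<le> card I * (k + t)"
    using excess V by (intro fisher_type_bound[OF _ _ blocks cover degree \<open>0 < t\<close>]) (auto simp: I_def)
  then show ?thesis using V xs by (auto simp: I_def)
qed

section \<open>Affine planes and the upper bound\<close>

text \<open>Each point lies on \<open>(q^2 - 1) / (q - 1) = q + 1\<close> lines; counting incident
  point-line pairs in two ways then determines the number of lines.\<close>

lemma affine_plane_size:
  assumes "affine_plane q V B" "2 \<le> q"
  shows "size B = q\<^sup>2 + q"
proof -
  obtain xs where xs: "mset xs = B" using ex_mset by blast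
  define I where "I = {..<length xs}"
  have I: "finite I" by (simp add: I_def)
  have design: "design (q\<^sup>2) q 1 V B" using assms by (simp add: affine_plane_def)
  have V: "finite V" "card V = q\<^sup>2" using design by (auto simp: design_def)
  have blocks: "xs ! i \<subseteq> V \<and> card (xs ! i) = q" if "i \<in> I" for i
  proof -
    have "xs ! i \<in># B" using that xs by (auto simp: I_def)
    then show ?thesis using design by (auto simp: design_def)
  qed
  have pair: "joint_degree I ((!) xs) x y = 1" if "x \<in> V" "y \<in> V" "x \<noteq> y" for x y
    using design that
    by (auto simp: design_def joint_degree_def I_def size_filter_mset_mset simp flip: xs)
  have degree: "joint_degree I ((!) xs) x x = q + 1" if "x \<in> V" for x
  proof -
    have "joint_degree I ((!) xs) x x * (q - 1) = (\<Sum>y\<in>V-{x}. joint_degree I ((!) xs) x y)"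
      by (rule sum_joint_degree_neq[OF I V(1) blocks, symmetric])
    also have "\<dots> = (\<Sum>y\<in>V-{x}. 1)"
      using pair that by (intro sum.cong) auto
    also have "\<dots> = (q + 1) * (q - 1)"
      using V that by (cases q) (auto simp: power2_eq_square)
    finally show ?thesis using assms(2) by (subst (asm) mult_cancel2) auto
  qed
  have "card I * q = (\<Sum>x\<in>V. joint_degree I ((!) xs) x x)"
    using sum_degree[OF I V(1) blocks] by simp
  also have "\<dots> = (q\<^sup>2 + q) * q"
    using V degree by (simp add: power2_eq_square algebra_simps)
  finally have "card I = q\<^sup>2 + q" using assms(2) by simp
  then show ?thesis using xs by (auto simp: I_def)
qed

text \<open>The case \<open>x = y\<close> serves two copies of the same point in the blow-up; there
  a line through \<open>x\<close> and any second point works.\<close>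

lemma affine_plane_line_through:
  assumes "affine_plane q V B" "2 \<le> q" "x \<in> V" "y \<in> V"
  shows "\<exists>L\<in>#B. x \<in> L \<and> y \<in> L"
proof -
  have line: "\<exists>L\<in>#B. x \<in> L \<and> y \<in> L" if "x \<noteq> y" "y \<in> V" for y
  proof -
    have "size {#b \<in># B. x \<in> b \<and> y \<in> b#} = 1"
      using assms that by (auto simp: affine_plane_def design_def)
    then have "{#b \<in># B. x \<in> b \<and> y \<in> b#} \<noteq> {#}" by (metis size_empty zero_neq_one)
    then obtain L where "L \<in># {#b \<in># B. x \<in> b \<and> y \<in> b#}" by (rule multiset_nonemptyE)
    then show ?thesis by auto
  qed
  have "1 < card V"
    using assms one_less_power[of q 2] by (simp add: affine_plane_def design_def)
  then have "\<exists>y\<in>V. x \<noteq> y"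
    by (metis assms(3) card_le_Suc0_iff_eq card.infinite le_numeral_extra(4) less_le_not_le
        not_one_le_zero One_nat_def)
  then show ?thesis using line assms(4) by metis
qed

text \<open>The bound \<open>v \<le> s * q^2\<close> provides enough copies of points, and
  \<open>s * q \<le> v\<close> leaves room to pad every blown-up line to exactly
  \<open>s * q\<close> points.\<close>

lemma covering_from_affine_plane:
  assumes plane: "affine_plane q P L" and q: "2 \<le> q" and "v \<le> s * q\<^sup>2" "s * q \<le> v"
  shows "\<exists>(V :: nat set) B. covering v (s * q) 1 V B \<and> size B = q\<^sup>2 + q"
proof -
  have P: "finite P" "card P = q\<^sup>2"
    using plane by (auto simp: affine_plane_def design_def)
  obtain e where e: "bij_betw e {..<q\<^sup>2} P"
    using ex_bij_betw_nat_finite[OF P(1)] P(2) by (auto simp: atLeast0LessThan)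
  \<comment> \<open>The number \<open>i\<close> is a copy of the point \<open>e (i div s)\<close>. A
    point has at most \<open>s\<close> copies, since these lie in one interval of length
    \<open>s\<close>, possibly cut off at \<open>v\<close>.\<close>
  define blow where "blow l = {i \<in> {..<v}. e (i div s) \<in> l}" for l
  have div_less: "i div s < q\<^sup>2" if "i < v" for i
    using that assms(3) by (intro less_mult_imp_div_less) (simp add: mult.commute)
  have blow_card: "card (blow l) \<le> s * q" if "l \<in># L" for l
  proof -
    have l: "l \<subseteq> P" "card l = q" using that plane by (auto simp: affine_plane_def design_def)
    define J where "J = {j \<in> {..<q\<^sup>2}. e j \<in> l}"
    have "card J = q"
    proof -
      have "e ` J = l" using l e by (auto simp: J_def bij_betw_def)
      moreover have "inj_on e J"
        using e by (auto simp: J_def bij_betw_def intro: inj_on_subset)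
      ultimately show ?thesis using l card_image by metis
    qed
    have "blow l \<subseteq> (\<Union>j\<in>J. {j * s..<j * s + s})"
    proof
      fix i assume i: "i \<in> blow l"
      then have "i div s \<in> J" using div_less by (auto simp: blow_def J_def)
      moreover have "0 < s" using i assms(3) by (auto simp: blow_def intro: gr0I)
      then have "i \<in> {i div s * s..<i div s * s + s}"
        using div_mult_mod_eq[of i s] mod_less_divisor[of s i] by (simp, linarith)
      ultimately show "i \<in> (\<Union>j\<in>J. {j * s..<j * s + s})" by blast
    qed
    then have "card (blow l) \<le> card (\<Union>j\<in>J. {j * s..<j * s + s})"
      by (intro card_mono) (auto simp: J_def)
    also have "\<dots> \<le> (\<Sum>j\<in>J. card {j * s..<j * s + s})"
      by (intro card_UN_le) (auto simp: J_def)
    finally show ?thesis using \<open>card J = q\<close> by (simp add: mult.commute)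
  qed
  have "\<exists>C. blow l \<subseteq> C \<and> C \<subseteq> {..<v} \<and> card C = s * q" if "l \<in># L" for l
    using exists_subset_between[of "blow l" "s * q" "{..<v}"] blow_card[OF that] assms(4)
    by (auto simp: blow_def)
  then obtain pad where pad: "\<And>l. l \<in># L \<Longrightarrow>
      blow l \<subseteq> pad l \<and> pad l \<subseteq> {..<v} \<and> card (pad l) = s * q"
    by metis
  have "covering v (s * q) 1 {..<v} (image_mset pad L)"
    unfolding covering_def
  proof (intro conjI ballI impI)
    fix x y assume xy: "x \<in> {..<v}" "y \<in> {..<v}"
    then have "e (x div s) \<in> P" "e (y div s) \<in> P"
      using e div_less by (auto simp: bij_betw_def)
    then obtain l where l: "l \<in># L" "e (x div s) \<in> l" "e (y div s) \<in> l"
      using affine_plane_line_through[OF plane q] by blast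
    then have "x \<in> blow l" "y \<in> blow l" using xy by (auto simp: blow_def)
    then have "pad l \<in># {#b \<in># image_mset pad L. x \<in> b \<and> y \<in> b#}"
      using pad l(1) by auto
    then have "{#b \<in># image_mset pad L. x \<in> b \<and> y \<in> b#} \<noteq> {#}"
      by (metis empty_iff set_mset_empty)
    then show "1 \<le> size {#b \<in># image_mset pad L. x \<in> b \<and> y \<in> b#}"
      by (metis One_nat_def Suc_le_eq nonempty_has_size)
  qed (use pad in auto)
  moreover have "size (image_mset pad L) = q\<^sup>2 + q"
    using affine_plane_size[OF plane q] by simp
  ultimately show ?thesis by blast
qed

section \<open>The numerical condition on \<open>v\<close>\<close>

theorem theorem7p2:
  fixes q s v :: nat and z :: real
  assumes "q \<ge> 2"
    and "\<exists>(V :: nat set) B. affine_plane q V B"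
    and "s \<ge> 2 * q + 1"
    and "z = (if s \<le> 4 * q + 1
              then min (real q - 1)
                     ((real q * (real s - 2 * real q - 1) + 2) / (real q + 1))
              else ((real q)\<^sup>2 * (real s - real q - 2) - real q + 2)
                     / (3 * (real q)\<^sup>2 + 3 * real q - 2))"
    and "real s * (real q)\<^sup>2 - real q + 1 - z < real v"
    and "v \<le> s * q\<^sup>2"
  shows "covering_number 1 v (s * q) = q\<^sup>2 + q"
proof -
  \<comment> \<open>This is \<open>q * (s * q - 1) - (v - 1)\<close>, the total surplus at a point
    of degree \<open>q\<close>. It is taken as a real number because it may be negative.\<close>
  define D where "D = real s * (real q)\<^sup>2 - real q + 1 - real v"
  have q: "2 \<le> real q" using assms(1) by simp
  have s: "2 * real q + 1 \<le> real s" using assms(3) by linarith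
  have "D < z" using assms(5) by (simp add: D_def)
  have small: "D < real q - 1 \<and> D * (real q + 1) < real q * (real s - 2 * real q - 1) + 2"
    if "s \<le> 4 * q + 1"
    using \<open>D < z\<close> that q by (simp add: assms(4) pos_less_divide_eq)
  have large: "D * (3 * (real q)\<^sup>2 + 3 * real q - 2)
      < (real q)\<^sup>2 * (real s - real q - 2) - real q + 2" if "\<not> s \<le> 4 * q + 1"
  proof -
    have "0 < 3 * (real q)\<^sup>2 + 3 * real q - 2"
      using q zero_le_power2[of "real q"] by linarith
    then show ?thesis using \<open>D < z\<close> that by (simp add: assms(4) pos_less_divide_eq)
  qed
  \<comment> \<open>A crude bound behind both \<open>k_le_v\<close> and \<open>low\<close>. For
    large \<open>s\<close> it holds because \<open>3 * q^2 + 3 * q - 2\<close> exceeds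
    \<open>q^2\<close>; otherwise already \<open>D < q - 1 < s\<close>.\<close>
  have D_less_s: "D < s"
  proof (rule ccontr)
    assume "\<not> D < s"
    then have Ds: "real s \<le> D" by simp
    have "real s * (3 * (real q)\<^sup>2 + 3 * real q - 2) \<le> D * (3 * (real q)\<^sup>2 + 3 * real q - 2)"
      using Ds q zero_le_power2[of "real q"] by (intro mult_right_mono) linarith+
    moreover have "0 \<le> real s * (2 * (real q)\<^sup>2 + 3 * real q - 2)"
      using q zero_le_power2[of "real q"] by (intro mult_nonneg_nonneg) linarith+
    moreover have "(real q)\<^sup>2 * (real s - real q - 2) \<le> (real q)\<^sup>2 * real s"
      by (intro mult_left_mono) auto
    then have "D * (3 * (real q)\<^sup>2 + 3 * real q - 2) < (real q)\<^sup>2 * real s - real q + 2"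
      if "\<not> s \<le> 4 * q + 1"
      using large that by linarith
    ultimately have "s \<le> 4 * q + 1" using q by (auto simp: algebra_simps)
    then show False using small Ds s q by linarith
  qed
  have sq: "real s * 2 \<le> real s * real q" using q by (intro mult_left_mono) auto
  have sqq: "2 * (real s * real q) \<le> real s * (real q)\<^sup>2"
    using q mult_left_mono[of 2 "real q" "real s * real q"] by (simp add: power2_eq_square mult_ac)
  have v: "real v = real s * (real q)\<^sup>2 - real q + 1 - D" by (simp add: D_def)
  have "real (s * q) \<le> real v"
    unfolding of_nat_mult using v D_less_s sq sqq s q by linarith
  then have k_le_v: "s * q \<le> v" by linarith
  have k_pos: "1 \<le> s * q" using assms(1,3) by simp
  have cast: "real (q - 1) = real q - 1" "real (s * q - 1) = real s * real q - 1"
      "real (v - 1) = real v - 1"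
    using assms(1) k_pos order_trans[OF k_pos k_le_v] by (simp_all add: of_nat_diff)
  \<comment> \<open>Degree \<open>q - 1\<close> is too small to meet all other points, so every
    point of a covering has degree at least \<open>q\<close>.\<close>
  have low: "(q - 1) * (s * q - 1) < v - 1"
  proof -
    have "(real q - 1) * (real s * real q - 1)
        = real s * (real q)\<^sup>2 - real q - real s * real q + 1"
      by (simp add: algebra_simps power2_eq_square)
    then have "real ((q - 1) * (s * q - 1)) < real (v - 1)"
      unfolding of_nat_mult[of "q - 1"] cast using v D_less_s sq s q by linarith
    then show ?thesis by linarith
  qed
  have lower: "q\<^sup>2 + q \<le> size B" if cov: "covering v (s * q) 1 V B" for V :: "nat set" and B
  proof (rule ccontr)
    assume "\<not> q\<^sup>2 + q \<le> size B"
    then have "size B + 1 \<le> q\<^sup>2 + q" by simp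
    then have "real (size B + 1) \<le> real (q\<^sup>2 + q)" by (simp only: of_nat_le_iff)
    then have B: "real (size B) \<le> (real q)\<^sup>2 + real q - 1" by simp
    \<comment> \<open>The condition on \<open>D\<close> is the hypothesis \<open>excess\<close> of
      \<open>covering_size_bound\<close> with \<open>r = q\<close>; the number of blocks is replaced
      by its assumed maximum \<open>q^2 + q - 1\<close>.\<close>
    have bound: "real v * (real q + 1) \<le> ((real q)\<^sup>2 + real q - 1) * (real s * real q + real t)"
      if "0 < t" and less: "D < real t * (real q - 1)" for t
    proof -
      have "real (q * (s * q - 1)) < real (v - 1 + t * (q - 1))"
        unfolding of_nat_add of_nat_mult[of q] of_nat_mult[of t] cast using v less
        by (simp add: algebra_simps power2_eq_square)
      then have "q * (s * q - 1) < v - 1 + t * (q - 1)" by linarith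
      then have "v * (q + 1) \<le> size B * (s * q + t)"
        by (rule covering_size_bound[OF cov \<open>0 < t\<close> low])
      then have "real (v * (q + 1)) \<le> real (size B * (s * q + t))" by (simp only: of_nat_le_iff)
      also have "\<dots> = real (size B) * (real s * real q + real t)" by simp
      also have "\<dots> \<le> ((real q)\<^sup>2 + real q - 1) * (real s * real q + real t)"
        using B by (intro mult_right_mono) auto
      finally show ?thesis by (simp add: distrib_left)
    qed
    show False
    proof (cases "D < real q - 1")
      case True
      \<comment> \<open>For \<open>s \<ge> 4 * q + 2\<close> this follows from
        \<open>D < q - 1\<close>: the left side is at most \<open>q^2 - 1\<close>, the right side at
        least \<open>2 * q^2 + q + 2\<close>.\<close>
      have "D * (real q + 1) < real q * (real s - 2 * real q - 1) + 2"
      proof (cases "s \<le> 4 * q + 1")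
        case False
        then have "2 * real q + 1 \<le> real s - 2 * real q - 1" by linarith
        then have "real q * (2 * real q + 1) \<le> real q * (real s - 2 * real q - 1)"
          by (intro mult_left_mono) auto
        moreover have "D * (real q + 1) \<le> (real q - 1) * (real q + 1)"
          using True by (intro mult_right_mono) auto
        moreover have "2 * 2 \<le> real q * real q" using q by (intro mult_mono) auto
        ultimately show ?thesis using q by (simp add: algebra_simps)
      qed (use small in blast)
      \<comment> \<open>One class suffices here. With \<open>t = 1\<close>, \<open>bound\<close>
        rearranges to exactly the reverse inequality, which explains the second entry of the minimum
        in \<open>z\<close>.\<close>
      then show False
        using bound[of 1] True v by (simp add: algebra_simps power2_eq_square)
    next
      case False
      then have D_large: "D * (3 * (real q)\<^sup>2 + 3 * real q - 2)
          < (real q)\<^sup>2 * (real s - real q - 2) - real q + 2"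
        using small large by blast
      \<comment> \<open>\<open>D\<close> is an integer and positive in this case, so nothing is lost
        by rounding.\<close>
      define d where "d = nat \<lfloor>D\<rfloor>"
      have "D = of_int (int s * (int q)\<^sup>2 - int q + 1 - int v)" by (simp add: D_def)
      then have d: "D = real d" using False q by (simp add: d_def)
      have d_ge: "q - 1 \<le> d" using False d assms(1) by linarith
      \<comment> \<open>\<open>j + 1\<close> is the least \<open>t\<close> with
        \<open>D < t * (q - 1)\<close>.\<close>
      define j where "j = d div (q - 1)"
      define i where "i = d mod (q - 1)"
      have d_eq: "d = j * (q - 1) + i" unfolding i_def j_def by (rule div_mult_mod_eq[symmetric])
      have "i < q - 1" using assms(1) by (simp add: i_def)
      have "1 \<le> j" using d_ge assms(1) by (simp add: j_def div_greater_zero_iff Suc_le_eq)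
      have d_real: "real d = real j * (real q - 1) + real i"
        using d_eq assms(1) by (simp add: of_nat_diff)
      have "D < real (j + 1) * (real q - 1)"
        using d d_real \<open>i < q - 1\<close> by (simp add: algebra_simps)
      then have "real v * (real q + 1)
          \<le> ((real q)\<^sup>2 + real q - 1) * (real s * real q + real (j + 1))"
        by (intro bound) auto
      \<comment> \<open>The factor \<open>q\<close> allows \<open>(j + 1) * q\<close> to be replaced
        by \<open>2 * (D + 1)\<close>, which is linear in \<open>D\<close>; the difference is
        \<open>(j - 1) * (q - 2) + 2 * i \<ge> 0\<close>. The result rearranges to exactly the
        reverse of \<open>D_large\<close>, whence the form of \<open>z\<close> for large
        \<open>s\<close>.\<close>
      then have "real v * (real q + 1) * real q
          \<le> ((real q)\<^sup>2 + real q - 1) * (real s * real q + real (j + 1)) * real q"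
        by (intro mult_right_mono) auto
      also have "\<dots> = ((real q)\<^sup>2 + real q - 1) * (real s * (real q)\<^sup>2 + real (j + 1) * real q)"
        by (simp add: algebra_simps power2_eq_square)
      also have "\<dots> \<le> ((real q)\<^sup>2 + real q - 1) * (real s * (real q)\<^sup>2 + 2 * (D + 1))"
      proof -
        have "0 \<le> (real j - 1) * (real q - 2)" using \<open>1 \<le> j\<close> q by simp
        then have "real (j + 1) * real q \<le> 2 * (D + 1)"
          using d d_real by (simp add: algebra_simps)
        then show ?thesis using q zero_le_power2[of "real q"] by (intro mult_left_mono) linarith+
      qed
      finally show False using D_large v by (simp add: algebra_simps power2_eq_square)
    qed
  qed
  obtain P :: "nat set" and L where "affine_plane q P L" using assms(2) by blast
  then have "\<exists>(V :: nat set) B. covering v (s * q) 1 V B \<and> size B = q\<^sup>2 + q"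
    using covering_from_affine_plane assms(1,6) k_le_v by blast
  then show ?thesis
    unfolding covering_number_def using lower by (intro Least_equality) blast+
qed

end
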